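(* Let $\mathcal F$ be a simplicial function space that has simplicial extension operators $E_m\colon\mathring{\mathcal F}(T^m)\to\mathcal F(Q^{m+1})$ for every $m<n$ for some nonnegative integer $n$. Then for every simplicial complex $\mathcal T$ of dimension at most $n$, with $\mathfrak T$ its partially ordered set of faces, there are local extension operators $E_F^{\mathcal T}\colon\mathring{\mathcal F}(F)\to\mathcal F(\mathcal T)$, $F\in\mathfrak T$, with which we have a geometric decomposition $$\mathcal F(\mathcal T)=\bigoplus_{F\in\mathfrak T}E_F^{\mathcal T}\mathring{\mathcal F}(F),$$ and, presuming we have chosen, for every $F\in\mathfrak T$, a subspace $\mathring{\mathcal F}(F)^\dagger$ of $\mathcal F(F)^*$ that is mapped isomorphically onto $\mathring{\mathcal F}(F)^*$ by restriction of functionals to $\mathring{\mathcal F}(F)$, a dual decomposition $$\mathcal F(\mathcal T)^*=\bigoplus_{F\in\mathfrak T}\left(\operatorname{tr}^{\mathcal T}_F\right)^*\mathring{\mathcal F}(F)^\dagger.$$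
   Context: $V^*$ denotes the dual space of $V$, and for a linear map $A\colon V\to W$ the dual map $A^*\colon W^*\to V^*$ is $A^*\alpha=\alpha\circ A$. $K\le F$ means that $K$ is a face of $F$ (possibly $K=F$); $\mathfrak T$ is the set of all faces (vertices, edges, etc.) of $\mathcal T$ ordered by inclusion. A simplicial map between simplices $K$ and $F$ is an affine function $K\to F$ that sends vertices to vertices (not necessarily injective). A simplicial function space $\mathcal F$ assigns a vector space $\mathcal F(F)$ to every simplex $F$ and a linear map $\Phi^*\colon\mathcal F(F)\to\mathcal F(K)$ (pullback) to every simplicial map $\Phi\colon K\to F$, such that $\mathrm{id}_F^*$ is the identity on $\mathcal F(F)$ and $(\Psi\circ\Phi)^*=\Phi^*\Psi^*$ for all simplicial maps $\Phi\colon K\to G$, $\Psi\colon G\to F$. For $K\le F$, the trace $\operatorname{tr}^F_K\colon\mathcal F(F)\to\mathcal F(K)$ is the pullback via the inclusion $K\hookrightarrow F$. The subspace of vanishing trace is $\mathring{\mathcal F}(F)=\{\phi\in\mathcal F(F)\mid\operatorname{tr}^F_K\phi=0\text{ for all }K<F\}$. The global function space is $$\mathcal F(\mathcal T)=\Big\{(\phi_F)_{F\in\mathfrak T}\in\prod_{F\in\mathfrak T}\mathcal F(F)\;\Big|\;\operatorname{tr}^F_K\phi_F=\phi_K\text{ for all }K\le F\Big\},$$ with $\operatorname{tr}^{\mathcal T}_F\colon\mathcal F(\mathcal T)\to\mathcal F(F)$ the natural projections. For $K\in\mathfrak T$, a local extension operator is a linear map $E^{\mathcal T}_K\colon\mathring{\mathcal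 F}(K)\to\mathcal F(\mathcal T)$ such that $\operatorname{tr}^{\mathcal T}_KE^{\mathcal T}_K\colon\mathring{\mathcal F}(K)\to\mathcal F(K)$ is the inclusion and $\operatorname{tr}^{\mathcal T}_FE^{\mathcal T}_K=0$ for all $F\in\mathfrak T$ with $K\not\le F$. The condition on $\mathring{\mathcal F}(F)^\dagger\subseteq\mathcal F(F)^*$ means explicitly: for every $\alpha\in\mathring{\mathcal F}(F)^*$ there exists $\beta\in\mathring{\mathcal F}(F)^\dagger$ with $\beta(\phi)=\alpha(\phi)$ for all $\phi\in\mathring{\mathcal F}(F)$; and if $\beta\in\mathring{\mathcal F}(F)^\dagger$ satisfies $\beta(\phi)=0$ for all $\phi\in\mathring{\mathcal F}(F)$, then $\beta=0$. Let $\mathbb R^{m+1}$ have coordinates $(\lambda_0,\dots,\lambda_m)$ and standard basis vectors $e_0,\dots,e_m$. $T^m$ is the simplex with vertices $e_0,\dots,e_m$, and $Q^{m+1}$ is the simplex with vertices $0,e_0,\dots,e_m$; thus $T^m$ is a face of $Q^{m+1}$. A simplicial extension operator in dimension $m$ is a linear map $E_m\colon\mathring{\mathcal F}(T^m)\to\mathcal F(Q^{m+1})$ such that $\operatorname{tr}^{Q^{m+1}}_{T^m}E_m\colon\mathring{\mathcal F}(T^m)\to\mathcal F(T^m)$ is the inclusion and $\operatorname{tr}^{Q^{m+1}}_SE_m=0$ for every face $S$ of $Q^{m+1}$ with $T^m\not\le S$ (i.e. every face other than $T^m$ and $Q^{m+1}$).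
   Formalization: The simplicial complex is assumed to be finite; for an infinite complex (e.g. infinitely many isolated points with constants as function space) the global function space is a product and not the direct sum, so the claim fails as stated. *)

theory Defs
  imports
    "HOL-Analysis.Analysis"
    "HOL-Analysis.Finite_Function_Topology"
    "HOL-Library.Function_Algebras"
begin

text \<open>
  All simplices live in one space of finitely supported real sequences, the union of the
  coordinate spaces \<open>\<real>\<^sup>N\<close>. The library notions \<open>simplex\<close>, \<open>simplicial_complex\<close> and \<open>aff_dim\<close>
  require a Euclidean space of fixed dimension; the definitions below mirror them, except
  that the empty set counts neither as a simplex nor as a face.
\<close>

type_synonym pt = "nat \<Rightarrow>\<^sub>0 real"

definition dim_simplex :: "nat \<Rightarrow> pt set \<Rightarrow> bool" where
  "dim_simplex d S \<longleftrightarrow>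
     (\<exists>C. finite C \<and> \<not> affine_dependent C \<and> card C = Suc d \<and> S = convex hull C)"

definition is_simplex :: "pt set \<Rightarrow> bool" where
  "is_simplex S \<longleftrightarrow> (\<exists>d. dim_simplex d S)"

definition simplex_face :: "pt set \<Rightarrow> pt set \<Rightarrow> bool" where
  "simplex_face K F \<longleftrightarrow> K face_of F \<and> K \<noteq> {}"

text \<open>A complex is represented by the set of all its faces.\<close>

definition complex_of_simplices :: "pt set set \<Rightarrow> bool" where
  "complex_of_simplices \<TT> \<longleftrightarrow>
     finite \<TT> \<and>
     (\<forall>F\<in>\<TT>. is_simplex F) \<and>
     (\<forall>F\<in>\<TT>. \<forall>K. simplex_face K F \<longrightarrow> K \<in> \<TT>) \<and>
     (\<forall>F\<in>\<TT>. \<forall>G\<in>\<TT>. F \<inter> G \<noteq> {} \<longrightarrow> simplex_face (F \<inter> G) F \<and> simplex_face (F \<inter> G) G)"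

definition T_simplex :: "nat \<Rightarrow> pt set" where
  "T_simplex m = convex hull ((\<lambda>i. Poly_Mapping.single i 1) ` {..m})"

text \<open>The argument is \<open>m\<close>, so \<open>Q_simplex m\<close> is the simplex \<open>Q\<close> of dimension \<open>m + 1\<close>.\<close>

definition Q_simplex :: "nat \<Rightarrow> pt set" where
  "Q_simplex m = convex hull (insert 0 ((\<lambda>i. Poly_Mapping.single i 1) ` {..m}))"

text \<open>
  Simplicial maps are extensional functions, so that maps agreeing on \<open>K\<close> are equal; the
  inclusion of \<open>K\<close> is \<open>\<lambda>x\<in>K. x\<close>, and composites are formed by \<^const>\<open>compose\<close>.
\<close>

definition simplicial_map :: "pt set \<Rightarrow> pt set \<Rightarrow> (pt \<Rightarrow> pt) \<Rightarrow> bool" where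
  "simplicial_map K F \<Phi> \<longleftrightarrow>
     is_simplex K \<and> is_simplex F \<and> \<Phi> \<in> K \<rightarrow>\<^sub>E F \<and>
     (\<forall>x\<in>K. \<forall>y\<in>K. \<forall>u v. 0 \<le> u \<and> 0 \<le> v \<and> u + v = 1 \<longrightarrow>
        \<Phi> (u *\<^sub>R x + v *\<^sub>R y) = u *\<^sub>R \<Phi> x + v *\<^sub>R \<Phi> y) \<and>
     (\<forall>x. x extreme_point_of K \<longrightarrow> \<Phi> x extreme_point_of F)"


text \<open>
  Vector spaces are subspaces of an ambient vector space given by its scalar multiplication.
  Function types are added pointwise (\<open>Function_Algebras\<close>) and scaled by \<open>pointwise\<close>.
  A linear map between subspaces is a function on the ambient types whose values outside its
  domain are irrelevant.
\<close>

definition pointwise :: "('k \<Rightarrow> 'v \<Rightarrow> 'v) \<Rightarrow> 'k \<Rightarrow> ('a \<Rightarrow> 'v) \<Rightarrow> 'a \<Rightarrow> 'v" where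
  "pointwise smul c f = (\<lambda>x. smul c (f x))"

definition linear_map_on ::
  "('k::field \<Rightarrow> 'v::ab_group_add \<Rightarrow> 'v) \<Rightarrow> ('k \<Rightarrow> 'w::ab_group_add \<Rightarrow> 'w) \<Rightarrow>
   'v set \<Rightarrow> 'w set \<Rightarrow> ('v \<Rightarrow> 'w) \<Rightarrow> bool" where
  "linear_map_on s1 s2 V W f \<longleftrightarrow>
     f \<in> V \<rightarrow> W \<and>
     (\<forall>x\<in>V. \<forall>y\<in>V. f (x + y) = f x + f y) \<and>
     (\<forall>c. \<forall>x\<in>V. f (s1 c x) = s2 c (f x))"

text \<open>
  Functionals on a subspace \<open>V\<close> are normalised to vanish outside \<open>V\<close>. Hence equality of
  functionals is equality on \<open>V\<close>, and the dual is a subspace of the function space.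
\<close>

definition dual_space :: "('k::field \<Rightarrow> 'v::ab_group_add \<Rightarrow> 'v) \<Rightarrow> 'v set \<Rightarrow> ('v \<Rightarrow> 'k) set" where
  "dual_space smul V =
     {\<alpha>. linear_map_on smul (*) V UNIV \<alpha> \<and> (\<forall>x. x \<notin> V \<longrightarrow> \<alpha> x = 0)}"

definition dual_map :: "'v set \<Rightarrow> ('v \<Rightarrow> 'w) \<Rightarrow> ('w \<Rightarrow> 'k::zero) \<Rightarrow> 'v \<Rightarrow> 'k" where
  "dual_map V A \<alpha> = (\<lambda>x. if x \<in> V then \<alpha> (A x) else 0)"

definition is_direct_sum ::
  "('k::field \<Rightarrow> 'v::ab_group_add \<Rightarrow> 'v) \<Rightarrow> 'v set \<Rightarrow> 'i set \<Rightarrow> ('i \<Rightarrow> 'v set) \<Rightarrow> bool" where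
  "is_direct_sum smul V I W \<longleftrightarrow>
     finite I \<and> module.subspace smul V \<and>
     (\<forall>i\<in>I. module.subspace smul (W i) \<and> W i \<subseteq> V) \<and>
     (\<forall>x\<in>V. \<exists>!w. w \<in> (\<Pi>\<^sub>E i\<in>I. W i) \<and> x = (\<Sum>i\<in>I. w i))"


text \<open>
  The spaces \<open>\<F> F\<close> are subspaces of a common vector space \<open>'v\<close>. This loses no generality,
  since any family of vector spaces embeds in its direct sum. The pullback along
  \<open>\<Phi> : K \<rightarrow> F\<close> is \<open>pull K F \<Phi>\<close>.
\<close>

locale simplicial_function_space = vector_space smul
  for smul :: "'k::field \<Rightarrow> 'v::ab_group_add \<Rightarrow> 'v"
    and \<F> :: "pt set \<Rightarrow> 'v set"
    and pull :: "pt set \<Rightarrow> pt set \<Rightarrow> (pt \<Rightarrow> pt) \<Rightarrow> 'v \<Rightarrow> 'v" +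
  assumes subspace_\<F>: "is_simplex F \<Longrightarrow> subspace (\<F> F)"
    and pull_linear:
      "simplicial_map K F \<Phi> \<Longrightarrow> linear_map_on smul smul (\<F> F) (\<F> K) (pull K F \<Phi>)"
    and pull_id: "is_simplex F \<Longrightarrow> \<phi> \<in> \<F> F \<Longrightarrow> pull F F (\<lambda>x\<in>F. x) \<phi> = \<phi>"
    and pull_compose:
      "simplicial_map K G \<Phi> \<Longrightarrow> simplicial_map G F \<Psi> \<Longrightarrow> \<phi> \<in> \<F> F \<Longrightarrow>
         pull K F (compose K \<Psi> \<Phi>) \<phi> = pull K G \<Phi> (pull G F \<Psi> \<phi>)"

definition face_trace ::
  "(pt set \<Rightarrow> pt set \<Rightarrow> (pt \<Rightarrow> pt) \<Rightarrow> 'v \<Rightarrow> 'v) \<Rightarrow> pt set \<Rightarrow> pt set \<Rightarrow> 'v \<Rightarrow> 'v" where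
  "face_trace pull F K = pull K F (\<lambda>x\<in>K. x)"

definition vanishing_trace ::
  "(pt set \<Rightarrow> 'v::zero set) \<Rightarrow> (pt set \<Rightarrow> pt set \<Rightarrow> (pt \<Rightarrow> pt) \<Rightarrow> 'v \<Rightarrow> 'v) \<Rightarrow>
   pt set \<Rightarrow> 'v set" where
  "vanishing_trace \<F> pull F =
     {\<phi>\<in>\<F> F. \<forall>K. simplex_face K F \<and> K \<noteq> F \<longrightarrow> face_trace pull F K \<phi> = 0}"

text \<open>Families indexed by \<open>\<TT>\<close> are normalised to be zero outside \<open>\<TT>\<close>.\<close>

definition global_space ::
  "(pt set \<Rightarrow> 'v::zero set) \<Rightarrow> (pt set \<Rightarrow> pt set \<Rightarrow> (pt \<Rightarrow> pt) \<Rightarrow> 'v \<Rightarrow> 'v) \<Rightarrow>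
   pt set set \<Rightarrow> (pt set \<Rightarrow> 'v) set" where
  "global_space \<F> pull \<TT> =
     {\<phi>. (\<forall>F\<in>\<TT>. \<phi> F \<in> \<F> F) \<and> (\<forall>F. F \<notin> \<TT> \<longrightarrow> \<phi> F = 0) \<and>
          (\<forall>F\<in>\<TT>. \<forall>K\<in>\<TT>. simplex_face K F \<longrightarrow> face_trace pull F K (\<phi> F) = \<phi> K)}"

definition global_trace :: "pt set \<Rightarrow> (pt set \<Rightarrow> 'v) \<Rightarrow> 'v" where
  "global_trace F \<phi> = \<phi> F"

definition local_extension_operator ::
  "('k::field \<Rightarrow> 'v::ab_group_add \<Rightarrow> 'v) \<Rightarrow> (pt set \<Rightarrow> 'v set) \<Rightarrow>
   (pt set \<Rightarrow> pt set \<Rightarrow> (pt \<Rightarrow> pt) \<Rightarrow> 'v \<Rightarrow> 'v) \<Rightarrow> pt set set \<Rightarrow> pt set \<Rightarrow>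
   ('v \<Rightarrow> pt set \<Rightarrow> 'v) \<Rightarrow> bool" where
  "local_extension_operator smul \<F> pull \<TT> K E \<longleftrightarrow>
     linear_map_on smul (pointwise smul)
       (vanishing_trace \<F> pull K) (global_space \<F> pull \<TT>) E \<and>
     (\<forall>\<phi>\<in>vanishing_trace \<F> pull K. global_trace K (E \<phi>) = \<phi>) \<and>
     (\<forall>F\<in>\<TT>. \<not> simplex_face K F \<longrightarrow>
        (\<forall>\<phi>\<in>vanishing_trace \<F> pull K. global_trace F (E \<phi>) = 0))"

definition simplicial_extension_operator ::
  "('k::field \<Rightarrow> 'v::ab_group_add \<Rightarrow> 'v) \<Rightarrow> (pt set \<Rightarrow> 'v set) \<Rightarrow>
   (pt set \<Rightarrow> pt set \<Rightarrow> (pt \<Rightarrow> pt) \<Rightarrow> 'v \<Rightarrow> 'v) \<Rightarrow> nat \<Rightarrow> ('v \<Rightarrow> 'v) \<Rightarrow> bool" where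
  "simplicial_extension_operator smul \<F> pull m E \<longleftrightarrow>
     linear_map_on smul smul (vanishing_trace \<F> pull (T_simplex m)) (\<F> (Q_simplex m)) E \<and>
     (\<forall>\<phi>\<in>vanishing_trace \<F> pull (T_simplex m).
        face_trace pull (Q_simplex m) (T_simplex m) (E \<phi>) = \<phi>) \<and>
     (\<forall>S. simplex_face S (Q_simplex m) \<and> \<not> simplex_face (T_simplex m) S \<longrightarrow>
        (\<forall>\<phi>\<in>vanishing_trace \<F> pull (T_simplex m). face_trace pull (Q_simplex m) S (E \<phi>) = 0))"

text \<open>
  The dual map of the inclusion of the vanishing-trace subspace is restriction of functionals.
\<close>

definition dagger_space ::
  "('k::field \<Rightarrow> 'v::ab_group_add \<Rightarrow> 'v) \<Rightarrow> (pt set \<Rightarrow> 'v set) \<Rightarrow>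
   (pt set \<Rightarrow> pt set \<Rightarrow> (pt \<Rightarrow> pt) \<Rightarrow> 'v \<Rightarrow> 'v) \<Rightarrow> pt set \<Rightarrow> ('v \<Rightarrow> 'k) set \<Rightarrow> bool" where
  "dagger_space smul \<F> pull F D \<longleftrightarrow>
     module.subspace (pointwise (*)) D \<and> D \<subseteq> dual_space smul (\<F> F) \<and>
     bij_betw (dual_map (vanishing_trace \<F> pull F) (\<lambda>\<phi>. \<phi>))
       D (dual_space smul (vanishing_trace \<F> pull F))"

end

theory Submission
  imports Defs
begin

text \<open>
  The decomposition follows from two observations.

  First, a simplicial extension operator can be transplanted to any face \<open>K\<close> of dimension \<open>m\<close> of
  a complex. Identify the vertices of \<open>K\<close> with those of \<open>T\<^sup>m\<close>, and for each simplex \<open>F\<close> of the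
  complex let \<open>\<Phi> F\<close> be the simplicial map from \<open>F\<close> to \<open>Q\<^sup>m\<^sup>+\<^sup>1\<close> that follows this identification on the
  vertices of \<open>K\<close> and collapses every other vertex to the origin. The maps \<open>\<Phi> F\<close> restrict to each
  other along faces, so the pullbacks along them of a single element of \<open>\<F>(Q\<^sup>m\<^sup>+\<^sup>1)\<close> form a
  compatible family. If \<open>F\<close> does not contain \<open>K\<close>, then \<open>\<Phi> F\<close> misses a vertex of \<open>T\<^sup>m\<close>; the pullback
  factors through the trace on the image face, which does not contain \<open>T\<^sup>m\<close>, and this trace of an
  extension is zero. This is \<open>extension_from_simplicial_extension\<close>. A face of dimension \<open>n\<close> is
  maximal in the complex and needs no operator: extend by zero.

  Secondly, both decompositions are instances of triangular elimination
  (\<open>triangular_direct_sum\<close>): every summand is tested at every face, the matrix of tests is triangular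
  with respect to inclusion of faces, and its diagonal entries are injective with the range that
  the elimination requires. For the primal decomposition the test at \<open>K\<close> is the trace on \<open>K\<close>, and one eliminates
  from small faces to large ones: once the traces on all smaller faces are zero, the trace on \<open>F\<close>
  lies in the vanishing-trace space and is hit by exactly one extension. For the dual
  decomposition the test of a functional at \<open>K\<close> is its composite with the extension operator
  of \<open>K\<close>. Since \<open>\<beta> \<circ> tr F \<circ> E K\<close> is zero unless \<open>K \<le> F\<close>, the same matrix is now triangular in the
  opposite order, and one eliminates from large faces to small ones. The condition on
  the chosen space of functionals on \<open>\<F> F\<close> is exactly bijectivity on the diagonal. Only the set of
  faces enters the elimination as an index set, so the spaces may be infinite-dimensional.
\<close>

section \<open>Triangular direct sums\<close>

lemma vector_space_pointwise:
  assumes "vector_space s"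
  shows "vector_space (pointwise s)"
proof -
  interpret vector_space s by fact
  show ?thesis
    by unfold_locales (auto simp: pointwise_def scale_right_distrib scale_left_distrib fun_eq_iff)
qed

lemma linear_map_on_zero:
  assumes "vector_space s1" "vector_space s2" "linear_map_on s1 s2 V W f" "module.subspace s1 V"
  shows "f 0 = 0"
proof -
  interpret v1: vector_space s1 by fact
  interpret v2: vector_space s2 by fact
  have "f (s1 0 0) = s2 0 (f 0)" using assms(3) v1.subspace_0[OF assms(4)]
    unfolding linear_map_on_def by blast
  then show ?thesis by simp
qed

lemma subspace_linear_image:
  assumes "vector_space s1" "vector_space s2" "linear_map_on s1 s2 V W f" "module.subspace s1 V"
  shows "module.subspace s2 (f ` V)"
proof -
  interpret v1: vector_space s1 by fact
  interpret v2: vector_space s2 by fact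
  note f = assms(3)[unfolded linear_map_on_def]
  show ?thesis
  proof (rule v2.subspaceI)
    show "0 \<in> f ` V" using linear_map_on_zero[OF assms] v1.subspace_0[OF assms(4)] by (metis imageI)
    show "x + y \<in> f ` V" if "x \<in> f ` V" "y \<in> f ` V" for x y
      using that f v1.subspace_add[OF assms(4)] by (smt (verit) image_iff)
    show "s2 c x \<in> f ` V" if "x \<in> f ` V" for c x
      using that f v1.subspace_scale[OF assms(4)] by (smt (verit) image_iff)
  qed
qed

text \<open>
  Elimination along a rank function. The maps \<open>p i\<close> jointly detect zero, and the matrix with
  entries \<open>p j\<close> restricted to \<open>W i\<close> is triangular for the rank. The diagonal hypothesis asks for a
  solution only for those \<open>x\<close> that are already annihilated in lower rank, which is the situation
  that elimination produces: a trace on \<open>F\<close> lies in the vanishing-trace space only after the traces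
  on smaller faces have been cleared. The maps take values in any abelian group, so that both traces and restrictions of functionals can play the role of \<open>p\<close>.
\<close>

lemma triangular_direct_sum:
  fixes s :: "'k::field \<Rightarrow> 'v::ab_group_add \<Rightarrow> 'v" and p :: "'i \<Rightarrow> 'v \<Rightarrow> 'a::ab_group_add"
    and r :: "'i \<Rightarrow> nat"
  assumes "vector_space s" and I: "finite I" and V: "module.subspace s V"
    and W: "\<And>i. i \<in> I \<Longrightarrow> module.subspace s (W i)" "\<And>i. i \<in> I \<Longrightarrow> W i \<subseteq> V"
    and add: "\<And>i x y. i \<in> I \<Longrightarrow> x \<in> V \<Longrightarrow> y \<in> V \<Longrightarrow> p i (x + y) = p i x + p i y"
    and tri: "\<And>i j w. i \<in> I \<Longrightarrow> j \<in> I \<Longrightarrow> i \<noteq> j \<Longrightarrow> \<not> r i < r j \<Longrightarrow> w \<in> W i \<Longrightarrow> p j w = 0"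
    and diag: "\<And>i x. i \<in> I \<Longrightarrow> x \<in> V \<Longrightarrow> (\<And>j. j \<in> I \<Longrightarrow> r j < r i \<Longrightarrow> p j x = 0) \<Longrightarrow>
                 \<exists>!w. w \<in> W i \<and> p i w = p i x"
    and sep: "\<And>x. x \<in> V \<Longrightarrow> (\<And>i. i \<in> I \<Longrightarrow> p i x = 0) \<Longrightarrow> x = 0"
  shows "is_direct_sum s V I W"
proof -
  interpret vector_space s by fact
  have p0: "p i 0 = 0" if "i \<in> I" for i
    using add[OF that subspace_0[OF V] subspace_0[OF V]] by simp
  have p_diff: "p i (x - y) = p i x - p i y" if "i \<in> I" "x \<in> V" "y \<in> V" for i x y
    using add[OF that(1) subspace_diff[OF V that(2,3)] that(3)] by simp
  have p_sum: "p i (sum f J) = (\<Sum>j\<in>J. p i (f j))" if "i \<in> I" "finite J" "\<And>j. j \<in> J \<Longrightarrow> f j \<in> V" for i f J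
    using that(2,3)
  proof (induction J rule: finite_induct)
    case (insert j J)
    then have "sum f J \<in> V" by (intro subspace_sum[OF V]) auto
    with insert show ?case using add[OF that(1)] by simp
  qed (simp add: p0 that)
  have WV: "w i \<in> V" if "w \<in> Pi I W" "i \<in> I" for w i using that W(2) by blast
  have sumV: "(\<Sum>i\<in>I. w i) \<in> V" if "w \<in> Pi I W" for w
    using WV[OF that] by (intro subspace_sum[OF V]) auto
  \<comment> \<open>existence: clear the values \<open>p j\<close> rank by rank; a correction of rank \<open>k\<close> leaves lower ranks alone\<close>
  have peel: "\<exists>w\<in>Pi I W. \<forall>j\<in>I. r j < k \<longrightarrow> p j (x - (\<Sum>i\<in>I. w i)) = 0" if x: "x \<in> V" for x k
  proof (induction k)
    case 0
    show ?case using W(1) subspace_0 by (intro bexI[of _ "\<lambda>_. 0"]) auto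
  next
    case (Suc k)
    then obtain w where w: "w \<in> Pi I W" "\<And>j. j \<in> I \<Longrightarrow> r j < k \<Longrightarrow> p j (x - (\<Sum>i\<in>I. w i)) = 0" by blast
    define y where "y = x - (\<Sum>i\<in>I. w i)"
    have y: "y \<in> V" unfolding y_def by (intro subspace_diff[OF V] x sumV w)
    have "\<exists>u. u \<in> W i \<and> p i u = p i y" if "i \<in> I" "r i = k" for i
      using diag[OF that(1) y] w(2) that(2) unfolding y_def by blast
    then obtain u where u: "\<And>i. i \<in> I \<Longrightarrow> r i = k \<Longrightarrow> u i \<in> W i \<and> p i (u i) = p i y" by metis
    define u' where "u' i = (if r i = k then u i else 0)" for i
    have u': "u' \<in> Pi I W" using u W(1) subspace_0 by (auto simp: u'_def)
    have step: "p j (y - (\<Sum>i\<in>I. u' i)) = 0" if j: "j \<in> I" "r j < Suc k" for j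
    proof -
      have "p j (y - (\<Sum>i\<in>I. u' i)) = p j y - (\<Sum>i\<in>I. p j (u' i))"
        using j p_diff y sumV[OF u'] p_sum[OF j(1) I] WV[OF u'] by simp
      also have "(\<Sum>i\<in>I. p j (u' i)) = (\<Sum>i\<in>I. if i = j then p j (u' j) else 0)"
      proof (rule sum.cong)
        fix i assume i: "i \<in> I"
        have "p j (u' i) = 0" if "i \<noteq> j"
          using tri[OF i j(1) that, of "u i"] u[OF i] j p0 by (auto simp: u'_def)
        then show "p j (u' i) = (if i = j then p j (u' j) else 0)" by simp
      qed simp
      also have "\<dots> = p j (u' j)" using I j by simp
      finally show ?thesis using j u[OF j(1)] w(2)[OF j(1)] p0[OF j(1)]
        by (cases "r j = k") (auto simp: u'_def y_def)
    qed
    show ?case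
    proof (intro bexI[of _ "\<lambda>i. w i + u' i"] ballI impI)
      show "(\<lambda>i. w i + u' i) \<in> Pi I W" using w(1) u' W(1) subspace_add by (auto simp: Pi_iff)
      show "p j (x - (\<Sum>i\<in>I. w i + u' i)) = 0" if "j \<in> I" "r j < Suc k" for j
        using step[OF that] by (simp add: y_def sum.distrib diff_diff_eq)
    qed
  qed
  have ex: "\<exists>w. w \<in> Pi\<^sub>E I W \<and> x = (\<Sum>i\<in>I. w i)" if x: "x \<in> V" for x
  proof -
    obtain k where k: "\<And>i. i \<in> I \<Longrightarrow> r i < k"
      using I finite_nat_set_iff_bounded[of "r ` I"] by auto
    obtain w where w: "w \<in> Pi I W" "\<forall>j\<in>I. r j < k \<longrightarrow> p j (x - (\<Sum>i\<in>I. w i)) = 0" using peel[OF x] by blast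
    have "x - (\<Sum>i\<in>I. w i) = 0"
      by (rule sep) (use w k subspace_diff[OF V x sumV[OF w(1)]] in auto)
    then show ?thesis using w(1) by (intro exI[of _ "restrict w I"]) auto
  qed
  \<comment> \<open>uniqueness: a relation between summands is trivial, starting from the lowest rank\<close>
  have zero: "d i = 0" if d: "d \<in> Pi I W" "(\<Sum>i\<in>I. d i) = 0" and i: "i \<in> I" for d i
    using i
  proof (induction "r i" arbitrary: i rule: less_induct)
    case less
    have "0 = p i (\<Sum>j\<in>I. d j)" using d p0 less.prems by simp
    also have "\<dots> = (\<Sum>j\<in>I. p i (d j))" using p_sum[OF less.prems I] WV[OF d(1)] by blast
    also have "\<dots> = (\<Sum>j\<in>I. if j = i then p i (d i) else 0)"
    proof (rule sum.cong)
      fix j assume j: "j \<in> I"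
      have "p i (d j) = 0" if "j \<noteq> i"
        using tri[OF j less.prems that, of "d j"] less.hyps[OF _ j] d(1) j p0[OF less.prems]
        by (cases "r j < r i") auto
      then show "p i (d j) = (if j = i then p i (d i) else 0)" by simp
    qed simp
    also have "\<dots> = p i (d i)" using I less.prems by simp
    finally have "p i (d i) = p i 0" using p0 less.prems by simp
    moreover have "\<exists>!w. w \<in> W i \<and> p i w = p i 0"
      by (rule diag[OF less.prems subspace_0[OF V]]) (rule p0)
    ultimately show ?case using d(1) less.prems W(1) subspace_0 by blast
  qed
  have uniq: "w = w'" if w: "w \<in> Pi\<^sub>E I W" "w' \<in> Pi\<^sub>E I W" and eq: "(\<Sum>i\<in>I. w i) = (\<Sum>i\<in>I. w' i)" for w w'
  proof (rule PiE_ext[OF w])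
    fix i assume i: "i \<in> I"
    have "w i - w' i = 0"
    proof (rule zero[OF _ _ i])
      show "(\<lambda>i. w i - w' i) \<in> Pi I W" using w W(1) subspace_diff by (auto simp: Pi_iff PiE_iff)
      show "(\<Sum>i\<in>I. w i - w' i) = 0" using eq by (simp add: sum_subtractf)
    qed
    then show "w i = w' i" by simp
  qed
  have "\<forall>x\<in>V. \<exists>!w. w \<in> Pi\<^sub>E I W \<and> x = (\<Sum>i\<in>I. w i)" using ex uniq by metis
  then show ?thesis unfolding is_direct_sum_def using I V W by blast
qed

lemma subspace_dual_space:
  fixes s :: "'k::field \<Rightarrow> 'v::ab_group_add \<Rightarrow> 'v"
  assumes "vector_space s" "module.subspace s V"
  shows "module.subspace (pointwise (*)) (dual_space s V)"
proof -
  interpret vector_space s by fact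
  interpret fn: vector_space "pointwise (*) :: 'k \<Rightarrow> ('v \<Rightarrow> 'k) \<Rightarrow> 'v \<Rightarrow> 'k"
    by (rule vector_space_pointwise) unfold_locales
  show ?thesis
    by (rule fn.subspaceI)
      (auto simp: dual_space_def linear_map_on_def pointwise_def algebra_simps)
qed

lemma dual_space_zero:
  assumes "vector_space s" "module.subspace s V" "\<alpha> \<in> dual_space s V"
  shows "\<alpha> 0 = 0"
  using linear_map_on_zero[OF assms(1) vector_space_over_itself.vector_space_axioms _ assms(2)] assms(3)
  by (auto simp: dual_space_def)

lemma dual_map_mem_dual_space:
  assumes "linear_map_on s1 s2 V W A" "\<alpha> \<in> dual_space s2 W" "vector_space s1" "module.subspace s1 V"
  shows "dual_map V A \<alpha> \<in> dual_space s1 V"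
proof -
  interpret vector_space s1 by fact
  have "\<And>x. x \<in> V \<Longrightarrow> A x \<in> W" using assms(1) by (auto simp: linear_map_on_def)
  then show ?thesis using assms(1,2) subspace_add[OF assms(4)] subspace_scale[OF assms(4)]
    by (auto simp: dual_space_def linear_map_on_def dual_map_def)
qed

section \<open>Simplices and simplicial maps\<close>

text \<open>
  Both the simplicial maps and the functionals that cut out the faces of a simplex come from this
  extension, which reduces to linear extension after moving one point of \<open>C\<close> to the origin.
\<close>

lemma affine_independent_extend:
  fixes f :: "'a::real_vector \<Rightarrow> 'b::real_vector"
  assumes "\<not> affine_dependent C"
  obtains L b where "linear L" "\<And>v. v \<in> C \<Longrightarrow> b + L v = f v"
proof (cases "C = {}")
  case True
  then show ?thesis using that[of "\<lambda>_. 0" 0] by (simp add: linear_iff)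
next
  case False
  then obtain a where a: "a \<in> C" by blast
  with assms have "independent ((\<lambda>x. - a + x) ` (C - {a}))"
    using affine_dependent_iff_dependent2 by blast
  then obtain L :: "'a \<Rightarrow> 'b" where L: "linear L" "\<And>y. y \<in> (\<lambda>x. - a + x) ` (C - {a}) \<Longrightarrow> L y = f (a + y) - f a"
    using linear_independent_extend[of _ "\<lambda>y. f (a + y) - f a"] by blast
  have "(f a - L a) + L v = f v" if "v \<in> C" for v
  proof (cases "v = a")
    case False
    then have "L (- a + v) = f v - f a" using L(2)[of "- a + v"] that by force
    moreover have "L (- a + v) = L v - L a" using linear_diff[OF L(1), of v a] by simp
    ultimately have "L v - L a = f v - f a" by simp
    then show ?thesis by (metis add_diff_cancel_left' diff_add_eq diff_diff_eq2 eq_diff_eq add.commute)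
  qed simp
  then show ?thesis using that L(1) by blast
qed

lemma convex_hull_affine_image:
  assumes "linear L"
  shows "(\<lambda>x. b + L x) ` (convex hull C) = convex hull ((\<lambda>x. b + L x) ` C)"
proof -
  have "(\<lambda>x. b + L x) ` S = (+) b ` L ` S" for S by (simp add: image_image)
  then show ?thesis by (simp add: convex_hull_linear_image[OF assms] convex_hull_translation)
qed

text \<open>
  The affine functional that is \<open>0\<close> on \<open>B\<close> and \<open>1\<close> on \<open>C - B\<close> separates the affine hull of \<open>B\<close> from
  the convex hull of the remaining vertices.
\<close>

lemma face_of_convex_hull_vertex_subset:
  fixes C :: "'a::real_vector set"
  assumes "finite C" "\<not> affine_dependent C" "B \<subseteq> C"
  shows "convex hull B face_of convex hull C"
proof (rule face_of_convex_hulls)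
  obtain L :: "'a \<Rightarrow> real" and b where L: "linear L" "\<And>v. v \<in> C \<Longrightarrow> b + L v = (if v \<in> B then 0 else 1)"
    by (rule affine_independent_extend[OF assms(2), of "\<lambda>v. if v \<in> B then 0 else 1"]) blast
  have conv: "affine {x. b + L x = c}" for c
    unfolding affine_alt
    by (auto simp: linear_add[OF L(1)] linear_cmul[OF L(1)]) (auto simp: algebra_simps)
  have "affine hull B \<subseteq> {x. b + L x = 0}"
    by (rule hull_minimal) (use L(2) assms(3) conv in auto)
  moreover have "convex hull (C - B) \<subseteq> {x. b + L x = 1}"
    by (rule hull_minimal) (use L(2) conv in \<open>auto simp: affine_imp_convex\<close>)
  ultimately show "affine hull B \<inter> convex hull (C - B) = {}" by fastforce
qed (use assms in auto)

text \<open>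
  If a point \<open>x\<close> of a face has a convex representation in which \<open>v \<in> C\<close> has positive weight, then
  either \<open>x = v\<close> or \<open>x\<close> lies in an open segment from \<open>v\<close> to a point of the hull; in both cases \<open>v\<close>
  belongs to the face.
\<close>

lemma face_of_convex_hull_finite:
  fixes C :: "'a::real_vector set"
  assumes "finite C" and K: "K face_of convex hull C"
  shows "K = convex hull (K \<inter> C)"
proof
  show "convex hull (K \<inter> C) \<subseteq> K"
    by (rule hull_minimal) (use face_of_imp_convex[OF K] in auto)
  show "K \<subseteq> convex hull (K \<inter> C)"
  proof
    fix x assume x: "x \<in> K"
    then have "x \<in> convex hull C" using K face_of_imp_subset by blast
    then obtain u where u: "\<And>v. v \<in> C \<Longrightarrow> 0 \<le> u v" "sum u C = 1" "(\<Sum>v\<in>C. u v *\<^sub>R v) = x"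
      unfolding convex_hull_finite[OF \<open>finite C\<close>] by blast
    have pos: "v \<in> K" if v: "v \<in> C" "u v \<noteq> 0" for v
    proof -
      have sumC: "u v + sum u (C - {v}) = 1" "u v *\<^sub>R v + (\<Sum>w\<in>C-{v}. u w *\<^sub>R w) = x"
        using sum.remove[OF \<open>finite C\<close> v(1), of u] sum.remove[OF \<open>finite C\<close> v(1), of "\<lambda>w. u w *\<^sub>R w"] u by auto
      have nn: "0 \<le> sum u (C - {v})" by (rule sum_nonneg) (use u(1) in auto)
      show ?thesis
      proof (cases "sum u (C - {v}) = 0")
        case True
        then have "\<forall>w\<in>C-{v}. u w = 0"
          using u(1) \<open>finite C\<close> by (subst (asm) sum_nonneg_eq_0_iff) auto
        then have "(\<Sum>w\<in>C-{v}. u w *\<^sub>R w) = 0" by (simp add: sum.neutral)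
        with sumC True have "x = v" by simp
        with x show ?thesis by simp
      next
        case False
        \<comment> \<open>split \<open>x\<close> into its \<open>v\<close> part and the normalised mean \<open>y\<close> of the other vertices\<close>
        define s where "s = sum u (C - {v})"
        define y where "y = (\<Sum>w\<in>C-{v}. (u w / s) *\<^sub>R w)"
        have s: "0 < s" "u v = 1 - s" using nn False sumC(1) by (auto simp: s_def)
        have "y \<in> convex hull (C - {v})"
          unfolding convex_hull_finite[OF finite_Diff[OF \<open>finite C\<close>]] y_def
          using s u(1) by (auto intro!: exI[of _ "\<lambda>w. u w / s"] simp: s_def simp flip: sum_divide_distrib)
        then have y: "y \<in> convex hull C" by (meson Diff_subset hull_mono subsetD)
        have "s *\<^sub>R y = (\<Sum>w\<in>C-{v}. u w *\<^sub>R w)"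
          using s by (simp add: y_def scaleR_sum_right)
        with sumC(2) s have xe: "x = (1 - s) *\<^sub>R v + s *\<^sub>R y" by simp
        show ?thesis
        proof (cases "v = y")
          case True
          with xe have "x = v" by (simp flip: scaleR_left_distrib)
          with x show ?thesis by simp
        next
          case False
          have "0 < u v" using u(1)[OF v(1)] v(2) by simp
          then have "x \<in> open_segment v y"
            using xe s False by (auto simp: in_segment intro!: exI[of _ s])
          moreover have "v \<in> convex hull C" using v(1) by (rule hull_inc)
          ultimately show ?thesis using K x y unfolding face_of_def by blast
        qed
      qed
    qed
    have "x \<in> convex hull {v \<in> C. u v \<noteq> 0}"
    proof -
      have fin: "finite {v \<in> C. u v \<noteq> 0}" using \<open>finite C\<close> by simp
      have "sum u {v \<in> C. u v \<noteq> 0} = 1"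
        by (subst u(2)[symmetric], rule sum.mono_neutral_left) (use \<open>finite C\<close> in auto)
      moreover have "(\<Sum>v\<in>{v \<in> C. u v \<noteq> 0}. u v *\<^sub>R v) = x"
        by (subst u(3)[symmetric], rule sum.mono_neutral_left) (use \<open>finite C\<close> in auto)
      ultimately show ?thesis
        unfolding convex_hull_finite[OF fin]
        using u(1) by (intro CollectI exI[of _ u]) simp
    qed
    also have "\<dots> \<subseteq> convex hull (K \<inter> C)" by (rule hull_mono) (use pos in auto)
    finally show "x \<in> convex hull (K \<inter> C)" .
  qed
qed

definition vertices :: "'a::real_vector set \<Rightarrow> 'a set" where
  "vertices S = {x. x extreme_point_of S}"

lemma vertices_convex_hull:
  assumes "finite C" "\<not> affine_dependent C"
  shows "vertices (convex hull C) = C"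
proof -
  have "v extreme_point_of convex hull C" if "v \<in> C" for v
    using face_of_convex_hull_vertex_subset[OF assms, of "{v}"] that by (simp add: face_of_singleton)
  then show ?thesis by (auto simp: vertices_def extreme_point_of_convex_hull)
qed

lemma is_simplex_convex_hull:
  assumes "finite C" "\<not> affine_dependent C" "C \<noteq> {}"
  shows "is_simplex (convex hull C)"
proof -
  have "card C = Suc (card C - 1)" using assms by (simp add: card_gt_0_iff)
  then show ?thesis unfolding is_simplex_def dim_simplex_def using assms by blast
qed

lemma card_vertices: "dim_simplex d S \<Longrightarrow> card (vertices S) = Suc d"
  unfolding dim_simplex_def by (auto simp: vertices_convex_hull)

lemma is_simplexD:
  assumes "is_simplex S"
  shows "finite (vertices S)" "\<not> affine_dependent (vertices S)" "vertices S \<noteq> {}"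
    "convex hull (vertices S) = S"
  using assms unfolding is_simplex_def dim_simplex_def
  by (auto simp: vertices_convex_hull)

lemma convex_simplex: "is_simplex S \<Longrightarrow> convex S"
  by (metis convex_convex_hull is_simplexD(4))

lemma vertices_subset: "vertices S \<subseteq> S"
  by (auto simp: vertices_def extreme_point_of_def)

lemma simplex_face_refl: "is_simplex F \<Longrightarrow> simplex_face F F"
  using is_simplexD[of F] hull_subset[of "vertices F" convex] unfolding simplex_face_def
  by (metis convex_convex_hull face_of_refl subset_empty)

lemma simplex_face_trans: "simplex_face G K \<Longrightarrow> simplex_face K F \<Longrightarrow> simplex_face G F"
  by (auto simp: simplex_face_def intro: face_of_trans)

lemma simplex_face_subset: "simplex_face K F \<Longrightarrow> K \<subseteq> F"
  by (auto simp: simplex_face_def face_of_imp_subset)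

lemma vertices_face: "simplex_face K F \<Longrightarrow> vertices K = K \<inter> vertices F"
  by (auto simp: simplex_face_def vertices_def extreme_point_of_face)

lemma simplex_face_convex_hull:
  assumes "is_simplex F" "W \<subseteq> vertices F" "W \<noteq> {}"
  shows "simplex_face (convex hull W) F" "is_simplex (convex hull W)" "vertices (convex hull W) = W"
proof -
  note F = is_simplexD[OF assms(1)]
  have W: "finite W" "\<not> affine_dependent W"
    using F assms(2) finite_subset affine_independent_subset by blast+
  show "simplex_face (convex hull W) F"
    using face_of_convex_hull_vertex_subset[OF F(1,2) assms(2)] F(4) assms(3) by (simp add: simplex_face_def)
  show "is_simplex (convex hull W)" "vertices (convex hull W) = W"
    using W assms(3) by (simp_all add: is_simplex_convex_hull vertices_convex_hull)
qed

lemma is_simplex_face: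
  assumes "is_simplex F" "simplex_face K F"
  shows "is_simplex K"
proof -
  note F = is_simplexD[OF assms(1)]
  have "K = convex hull (K \<inter> vertices F)"
    using face_of_convex_hull_finite[OF F(1)] F(4) assms(2) by (simp add: simplex_face_def)
  moreover have "K \<noteq> {}" using assms(2) by (simp add: simplex_face_def)
  ultimately show ?thesis using simplex_face_convex_hull(2)[OF assms(1), of "K \<inter> vertices F"]
    by (metis convex_hull_eq_empty inf_le2)
qed

lemma simplex_face_iff_vertices:
  assumes "is_simplex K" "is_simplex F"
  shows "simplex_face K F \<longleftrightarrow> vertices K \<subseteq> vertices F"
  using assms simplex_face_convex_hull(1)[OF assms(2), of "vertices K"] is_simplexD[OF assms(1)]
    vertices_face[of K F] by auto

lemma simplex_eq_iff_vertices:
  "is_simplex K \<Longrightarrow> is_simplex F \<Longrightarrow> K = F \<longleftrightarrow> vertices K = vertices F"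
  by (metis is_simplexD(4))

lemma card_vertices_proper_face:
  assumes "is_simplex F" "simplex_face K F" "K \<noteq> F"
  shows "card (vertices K) < card (vertices F)"
proof (rule psubset_card_mono)
  show "finite (vertices F)" using assms(1) by (rule is_simplexD)
  show "vertices K \<subset> vertices F"
    using assms is_simplex_face simplex_face_iff_vertices simplex_eq_iff_vertices by blast
qed

text \<open>
  A simplicial map is only required to respect binary convex combinations on its domain. The
  affine function with the same vertex values agrees with it on a convex set containing the
  vertices, hence everywhere.
\<close>

lemma simplicial_map_affine:
  assumes "simplicial_map K F \<Phi>"
  obtains L b where "linear L" "\<And>x. x \<in> K \<Longrightarrow> \<Phi> x = b + L x"
proof -
  have K: "is_simplex K" using assms by (simp add: simplicial_map_def)
  obtain L b where L: "linear L" "\<And>v. v \<in> vertices K \<Longrightarrow> b + L v = \<Phi> v"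
    using affine_independent_extend[OF is_simplexD(2)[OF K]] by blast
  have "convex {x \<in> K. \<Phi> x = b + L x}"
  proof (rule convexI)
    fix x y u v assume xy: "x \<in> {x \<in> K. \<Phi> x = b + L x}" "y \<in> {x \<in> K. \<Phi> x = b + L x}"
      and uv: "0 \<le> u" "0 \<le> v" "u + v = (1::real)"
    have "convex K" by (rule convex_simplex[OF K])
    then have "u *\<^sub>R x + v *\<^sub>R y \<in> K" using xy uv by (auto simp: convex_def)
    moreover have "\<Phi> (u *\<^sub>R x + v *\<^sub>R y) = u *\<^sub>R (b + L x) + v *\<^sub>R (b + L y)"
      using assms xy uv by (auto simp: simplicial_map_def)
    moreover have "\<dots> = (u + v) *\<^sub>R b + L (u *\<^sub>R x + v *\<^sub>R y)"
      by (simp add: linear_add[OF L(1)] linear_cmul[OF L(1)] algebra_simps)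
    ultimately show "u *\<^sub>R x + v *\<^sub>R y \<in> {x \<in> K. \<Phi> x = b + L x}" using uv by simp
  qed
  then have "convex hull (vertices K) \<subseteq> {x \<in> K. \<Phi> x = b + L x}"
    by (intro hull_minimal) (use L(2) vertices_subset in auto)
  then show ?thesis using that[of L b] L(1) is_simplexD(4)[OF K] by auto
qed

lemma simplicial_map_vertices:
  "simplicial_map K F \<Phi> \<Longrightarrow> v \<in> vertices K \<Longrightarrow> \<Phi> v \<in> vertices F"
  by (auto simp: simplicial_map_def vertices_def)

lemma simplicial_map_image:
  assumes "simplicial_map K F \<Phi>"
  shows "\<Phi> ` K = convex hull (\<Phi> ` vertices K)"
proof -
  have K: "is_simplex K" using assms by (simp add: simplicial_map_def)
  obtain L b where L: "linear L" "\<And>x. x \<in> K \<Longrightarrow> \<Phi> x = b + L x"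
    using simplicial_map_affine[OF assms] by blast
  have "\<Phi> ` K = (\<lambda>x. b + L x) ` (convex hull vertices K)" using L(2) is_simplexD(4)[OF K] by auto
  also have "\<dots> = convex hull ((\<lambda>x. b + L x) ` vertices K)" by (rule convex_hull_affine_image[OF L(1)])
  also have "(\<lambda>x. b + L x) ` vertices K = \<Phi> ` vertices K"
    using L(2) vertices_subset[of K] by (intro image_cong) auto
  finally show ?thesis .
qed

text \<open>
  The set where two such maps agree is convex and contains the vertices.
\<close>

lemma simplicial_map_eqI:
  assumes "simplicial_map K F \<Phi>" "simplicial_map K F \<Psi>" "\<And>v. v \<in> vertices K \<Longrightarrow> \<Phi> v = \<Psi> v"
  shows "\<Phi> = \<Psi>"
proof -
  have K: "is_simplex K" using assms by (simp add: simplicial_map_def)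
  have "convex {x \<in> K. \<Phi> x = \<Psi> x}"
  proof (rule convexI)
    fix x y u v assume xy: "x \<in> {x \<in> K. \<Phi> x = \<Psi> x}" "y \<in> {x \<in> K. \<Phi> x = \<Psi> x}"
      and uv: "0 \<le> u" "0 \<le> v" "u + v = (1::real)"
    have "convex K" by (rule convex_simplex[OF K])
    then show "u *\<^sub>R x + v *\<^sub>R y \<in> {x \<in> K. \<Phi> x = \<Psi> x}"
      using xy uv assms(1,2) by (auto simp: simplicial_map_def convex_def)
  qed
  then have "convex hull (vertices K) \<subseteq> {x \<in> K. \<Phi> x = \<Psi> x}"
    by (intro hull_minimal) (use assms(3) vertices_subset in auto)
  then have "\<And>x. x \<in> K \<Longrightarrow> \<Phi> x = \<Psi> x" using is_simplexD(4)[OF K] by auto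
  moreover have "\<Phi> \<in> extensional K" "\<Psi> \<in> extensional K"
    using assms(1,2) by (auto simp: simplicial_map_def PiE_iff)
  ultimately show ?thesis by (metis extensionalityI)
qed

lemma simplicial_map_exists:
  assumes K: "is_simplex K" and F: "is_simplex F" and f: "\<And>v. v \<in> vertices K \<Longrightarrow> f v \<in> vertices F"
  shows "\<exists>\<Phi>. simplicial_map K F \<Phi> \<and> (\<forall>v\<in>vertices K. \<Phi> v = f v)"
proof -
  obtain L b where L: "linear L" "\<And>v. v \<in> vertices K \<Longrightarrow> b + L v = f v"
    using affine_independent_extend[OF is_simplexD(2)[OF K]] by blast
  have "(\<lambda>x. b + L x) ` K = convex hull ((\<lambda>x. b + L x) ` vertices K)"
    using convex_hull_affine_image[OF L(1), of b "vertices K"] by (simp add: is_simplexD(4)[OF K])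
  also have "\<dots> \<subseteq> convex hull (vertices F)" by (rule hull_mono) (use L(2) f in auto)
  finally have into: "b + L x \<in> F" if "x \<in> K" for x using that is_simplexD(4)[OF F] by auto
  have "convex K" by (rule convex_simplex[OF K])
  define \<Phi> where "\<Phi> = (\<lambda>x\<in>K. b + L x)"
  have "\<Phi> (u *\<^sub>R x + v *\<^sub>R y) = u *\<^sub>R \<Phi> x + v *\<^sub>R \<Phi> y"
    if "x \<in> K" "y \<in> K" "0 \<le> u \<and> 0 \<le> v \<and> u + v = 1" for x y u v
  proof -
    have "u *\<^sub>R x + v *\<^sub>R y \<in> K" using \<open>convex K\<close> that by (auto simp: convex_def)
    moreover have "u *\<^sub>R (b + L x) + v *\<^sub>R (b + L y) = (u + v) *\<^sub>R b + L (u *\<^sub>R x + v *\<^sub>R y)"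
      by (simp add: linear_add[OF L(1)] linear_cmul[OF L(1)] algebra_simps)
    ultimately show ?thesis using that by (simp add: \<Phi>_def)
  qed
  moreover have v: "\<Phi> v = f v" if "v \<in> vertices K" for v using that L(2) vertices_subset[of K] by (auto simp: \<Phi>_def)
  moreover have "x extreme_point_of K \<Longrightarrow> \<Phi> x extreme_point_of F" for x
    using v f by (simp add: vertices_def)
  moreover have "\<Phi> \<in> K \<rightarrow>\<^sub>E F" using into by (simp add: \<Phi>_def)
  ultimately show ?thesis using K F unfolding simplicial_map_def by blast
qed

lemma simplicial_map_inclusion:
  assumes "is_simplex F" "simplex_face K F"
  shows "simplicial_map K F (\<lambda>x\<in>K. x)"
proof -
  have K: "is_simplex K" using assms by (rule is_simplex_face)
  have "convex K" by (rule convex_simplex[OF K])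
  then show ?thesis using assms K simplex_face_subset[OF assms(2)]
    by (auto simp: simplicial_map_def convex_def simplex_face_def extreme_point_of_face)
qed

lemma simplicial_map_compose:
  assumes "simplicial_map K G \<Phi>" "simplicial_map G F \<Psi>"
  shows "simplicial_map K F (compose K \<Psi> \<Phi>)"
proof -
  have K: "is_simplex K" using assms by (simp add: simplicial_map_def)
  have F: "is_simplex F" using assms by (simp add: simplicial_map_def)
  have "convex K" by (rule convex_simplex[OF K])
  have into: "\<And>x. x \<in> K \<Longrightarrow> \<Phi> x \<in> G" "\<And>x. x \<in> G \<Longrightarrow> \<Psi> x \<in> F"
    using assms by (auto simp: simplicial_map_def)
  have "compose K \<Psi> \<Phi> (u *\<^sub>R x + v *\<^sub>R y) = u *\<^sub>R compose K \<Psi> \<Phi> x + v *\<^sub>R compose K \<Psi> \<Phi> y"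
    if "x \<in> K" "y \<in> K" "0 \<le> u \<and> 0 \<le> v \<and> u + v = 1" for x y u v
  proof -
    have "u *\<^sub>R x + v *\<^sub>R y \<in> K" using \<open>convex K\<close> that by (simp add: convex_def)
    moreover have "\<Phi> (u *\<^sub>R x + v *\<^sub>R y) = u *\<^sub>R \<Phi> x + v *\<^sub>R \<Phi> y"
      using assms(1) that unfolding simplicial_map_def by blast
    moreover have "\<Psi> (u *\<^sub>R \<Phi> x + v *\<^sub>R \<Phi> y) = u *\<^sub>R \<Psi> (\<Phi> x) + v *\<^sub>R \<Psi> (\<Phi> y)"
      using assms(2) into that unfolding simplicial_map_def by blast
    ultimately show ?thesis using that by (simp add: compose_def)
  qed
  moreover have "compose K \<Psi> \<Phi> x extreme_point_of F" if "x extreme_point_of K" for x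
    using that assms by (simp add: compose_def simplicial_map_def extreme_point_of_def)
  moreover have "compose K \<Psi> \<Phi> \<in> K \<rightarrow>\<^sub>E F" using into by (auto simp: compose_def)
  ultimately show ?thesis using K F unfolding simplicial_map_def by blast
qed

text \<open>
  The image is the convex hull of a set of vertices of the target, hence a face of it. Every
  simplicial map therefore factors through the inclusion of a face.
\<close>

lemma simplex_face_simplicial_image:
  assumes "simplicial_map K F \<Phi>"
  shows "simplex_face (\<Phi> ` K) F" "vertices (\<Phi> ` K) = \<Phi> ` vertices K"
    "simplicial_map K (\<Phi> ` K) \<Phi>"
proof -
  have K: "is_simplex K" and F: "is_simplex F" using assms by (auto simp: simplicial_map_def)
  have W: "\<Phi> ` vertices K \<subseteq> vertices F" "\<Phi> ` vertices K \<noteq> {}"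
    using simplicial_map_vertices[OF assms] is_simplexD(3)[OF K] by auto
  show f: "simplex_face (\<Phi> ` K) F" and v: "vertices (\<Phi> ` K) = \<Phi> ` vertices K"
    using simplex_face_convex_hull[OF F W] by (simp_all add: simplicial_map_image[OF assms])
  have "\<And>x. x extreme_point_of K \<Longrightarrow> \<Phi> x extreme_point_of (\<Phi> ` K)"
    using v by (auto simp: vertices_def)
  then show "simplicial_map K (\<Phi> ` K) \<Phi>"
    using assms is_simplex_face[OF F f] unfolding simplicial_map_def by blast
qed

abbreviation unit_vertex :: "nat \<Rightarrow> pt" where
  "unit_vertex i \<equiv> Poly_Mapping.single i 1"

lemma inj_unit_vertex: "inj unit_vertex"
  by (rule injI) (metis lookup_single_eq lookup_single_not_eq zero_neq_one)

lemma unit_vertex_nonzero: "unit_vertex i \<noteq> 0"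
  by (metis lookup_single_eq lookup_zero zero_neq_one)

lemma lookup_scaleR:
  fixes x :: "'a \<Rightarrow>\<^sub>0 'b::real_vector"
  shows "Poly_Mapping.lookup (r *\<^sub>R x) i = r *\<^sub>R Poly_Mapping.lookup x i"
proof -
  have "finite {i. r *\<^sub>R Poly_Mapping.lookup x i \<noteq> 0}"
    by (rule finite_subset[OF _ finite_lookup[of x]]) auto
  then show ?thesis by (simp add: scaleR_poly_mapping_def)
qed

lemma affine_independent_unit_vertices:
  "\<not> affine_dependent (insert 0 (unit_vertex ` {..m}))"
proof -
  have ind: "independent (unit_vertex ` {..m})"
  proof (rule independent_if_scalars_zero)
    fix u :: "pt \<Rightarrow> real" and x assume s: "(\<Sum>x\<in>unit_vertex ` {..m}. u x *\<^sub>R x) = 0" and x: "x \<in> unit_vertex ` {..m}"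
    obtain i where i: "i \<le> m" "x = unit_vertex i" using x by auto
    have "0 = (\<Sum>j\<le>m. u (unit_vertex j) *\<^sub>R unit_vertex j)"
      using s by (subst (asm) sum.reindex) (auto intro: inj_on_subset[OF inj_unit_vertex])
    then have "0 = Poly_Mapping.lookup (\<Sum>j\<le>m. u (unit_vertex j) *\<^sub>R unit_vertex j) i"
      by (metis lookup_zero)
    also have "\<dots> = (\<Sum>j\<le>m. if i = j then u (unit_vertex j) else 0)"
      by (subst lookup_sum, intro sum.cong) (auto simp: lookup_scaleR lookup_single when_def)
    also have "\<dots> = u x" using i by simp
    finally show "u x = 0" by simp
  qed simp
  have "0 \<notin> unit_vertex ` {..m}" using unit_vertex_nonzero by (auto simp: image_iff dest: sym)
  then show ?thesis using ind by (subst affine_dependent_iff_dependent) auto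
qed

lemma Q_simplex: "is_simplex (Q_simplex m)" "vertices (Q_simplex m) = insert 0 (unit_vertex ` {..m})"
  using affine_independent_unit_vertices[of m] unfolding Q_simplex_def
  by (auto intro!: is_simplex_convex_hull vertices_convex_hull)

lemma T_simplex:
  "is_simplex (T_simplex m)" "vertices (T_simplex m) = unit_vertex ` {..m}"
  using simplex_face_convex_hull[OF Q_simplex(1), of "unit_vertex ` {..m}" m] unfolding T_simplex_def Q_simplex(2)
  by auto

section \<open>Pullbacks and traces\<close>

context simplicial_function_space
begin

lemma pull_mem: "simplicial_map K F \<Phi> \<Longrightarrow> \<phi> \<in> \<F> F \<Longrightarrow> pull K F \<Phi> \<phi> \<in> \<F> K"
  and pull_add: "simplicial_map K F \<Phi> \<Longrightarrow> \<phi> \<in> \<F> F \<Longrightarrow> \<psi> \<in> \<F> F \<Longrightarrow>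
    pull K F \<Phi> (\<phi> + \<psi>) = pull K F \<Phi> \<phi> + pull K F \<Phi> \<psi>"
  and pull_scale: "simplicial_map K F \<Phi> \<Longrightarrow> \<phi> \<in> \<F> F \<Longrightarrow> pull K F \<Phi> (smul c \<phi>) = smul c (pull K F \<Phi> \<phi>)"
  using pull_linear[of K F \<Phi>] unfolding linear_map_on_def by blast+

lemma pull_zero: "simplicial_map K F \<Phi> \<Longrightarrow> pull K F \<Phi> 0 = 0"
  by (rule linear_map_on_zero[OF vector_space_axioms vector_space_axioms pull_linear subspace_\<F>])
    (auto simp: simplicial_map_def)

text \<open>
  Through this factorisation a pullback vanishes as soon as the trace on the image face does, even
  if the simplicial map collapses vertices.
\<close>

lemma pull_eq_pull_trace_image:
  assumes "simplicial_map K F \<Phi>" "\<phi> \<in> \<F> F"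
  shows "pull K F \<Phi> \<phi> = pull K (\<Phi> ` K) \<Phi> (face_trace pull F (\<Phi> ` K) \<phi>)"
proof -
  have F: "is_simplex F" using assms by (simp add: simplicial_map_def)
  note im = simplex_face_simplicial_image[OF assms(1)]
  have "\<Phi> \<in> extensional K" using assms(1) by (auto simp: simplicial_map_def PiE_iff)
  then have "compose K (\<lambda>x\<in>\<Phi> ` K. x) \<Phi> = \<Phi>"
    by (auto simp: compose_def extensional_def)
  then show ?thesis
    using pull_compose[OF im(3) simplicial_map_inclusion[OF F im(1)] assms(2)] by (simp add: face_trace_def)
qed

lemma trace_pull:
  assumes "simplicial_map F H \<Phi>" "simplex_face G F" "\<phi> \<in> \<F> H"
  shows "face_trace pull F G (pull F H \<Phi> \<phi>) = pull G H (compose G \<Phi> (\<lambda>x\<in>G. x)) \<phi>"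
  using assms pull_compose[OF simplicial_map_inclusion assms(1,3)]
  by (simp add: face_trace_def simplicial_map_def)

lemma subspace_vanishing_trace:
  assumes F: "is_simplex F"
  shows "subspace (vanishing_trace \<F> pull F)"
proof -
  note incl = simplicial_map_inclusion[OF F]
  show ?thesis
    using subspace_\<F>[OF F] unfolding vanishing_trace_def face_trace_def
    by (intro subspaceI; simp add: subspace_0 subspace_add subspace_scale pull_zero[OF incl]
          pull_add[OF incl] pull_scale[OF incl])
qed

lemma subspace_global_space:
  assumes T: "\<And>F. F \<in> \<TT> \<Longrightarrow> is_simplex F"
  shows "module.subspace (pointwise smul) (global_space \<F> pull \<TT>)"
proof -
  interpret fn: vector_space "pointwise smul :: 'k \<Rightarrow> (pt set \<Rightarrow> 'v) \<Rightarrow> pt set \<Rightarrow> 'v"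
    by (rule vector_space_pointwise[OF vector_space_axioms])
  note incl = simplicial_map_inclusion[OF T]
  show ?thesis
  proof (rule fn.subspaceI)
    show "0 \<in> global_space \<F> pull \<TT>"
      using T by (auto simp: global_space_def face_trace_def subspace_0 subspace_\<F> pull_zero[OF incl])
    show "x + y \<in> global_space \<F> pull \<TT>" if "x \<in> global_space \<F> pull \<TT>" "y \<in> global_space \<F> pull \<TT>" for x y
      using that T by (auto simp: global_space_def face_trace_def subspace_add subspace_\<F> pull_add[OF incl])
    show "pointwise smul c x \<in> global_space \<F> pull \<TT>" if "x \<in> global_space \<F> pull \<TT>" for c x
      using that T by (auto simp: global_space_def face_trace_def pointwise_def subspace_scale subspace_\<F> pull_scale[OF incl])
  qed
qed

text \<open>
  By the cardinality bound a proper face of \<open>K\<close> has too few vertices to be mapped onto \<open>F\<close>, so its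
  image is a proper face, where \<open>\<phi>\<close> has zero trace.
\<close>

lemma pull_vanishing_trace:
  assumes \<Phi>: "simplicial_map K F \<Phi>" and card: "card (vertices K) \<le> card (vertices F)"
    and \<phi>: "\<phi> \<in> vanishing_trace \<F> pull F"
  shows "pull K F \<Phi> \<phi> \<in> vanishing_trace \<F> pull K"
proof -
  have K: "is_simplex K" and F: "is_simplex F" using \<Phi> by (auto simp: simplicial_map_def)
  have mem: "\<phi> \<in> \<F> F" using \<phi> by (simp add: vanishing_trace_def)
  have "face_trace pull K S (pull K F \<Phi> \<phi>) = 0" if S: "simplex_face S K" "S \<noteq> K" for S
  proof -
    let ?\<Psi> = "compose S \<Phi> (\<lambda>x\<in>S. x)"
    have \<Psi>: "simplicial_map S F ?\<Psi>"
      using simplicial_map_compose[OF simplicial_map_inclusion[OF K S(1)] \<Phi>] .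
    note im = simplex_face_simplicial_image[OF \<Psi>]
    have "finite (vertices S)" using is_simplexD(1) is_simplex_face[OF K S(1)] by blast
    then have "card (vertices (?\<Psi> ` S)) \<le> card (vertices S)" unfolding im(2) by (rule card_image_le)
    also have "\<dots> < card (vertices F)" using card_vertices_proper_face[OF K S] card by simp
    finally have "?\<Psi> ` S \<noteq> F" by auto
    then have "face_trace pull F (?\<Psi> ` S) \<phi> = 0" using \<phi> im(1) by (simp add: vanishing_trace_def)
    then have "pull S F ?\<Psi> \<phi> = 0"
      using pull_eq_pull_trace_image[OF \<Psi> mem] pull_zero[OF im(3)] by simp
    then show ?thesis using trace_pull[OF \<Phi> S(1) mem] by simp
  qed
  then show ?thesis using pull_mem[OF \<Phi> mem] by (simp add: vanishing_trace_def)
qed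

section \<open>Local extension operators\<close>

text \<open>
  Extension by zero is compatible because \<open>\<phi>\<close> has zero traces and no larger face has to match
  \<open>\<phi>\<close>.
\<close>

lemma maximal_face_extension:
  assumes T: "\<And>F. F \<in> \<TT> \<Longrightarrow> is_simplex F" and K: "K \<in> \<TT>"
    and max: "\<And>F. F \<in> \<TT> \<Longrightarrow> simplex_face K F \<Longrightarrow> F = K"
  shows "local_extension_operator smul \<F> pull \<TT> K (\<lambda>\<phi> F. if F = K then \<phi> else 0)"
proof -
  have "(\<lambda>F. if F = K then \<phi> else 0) \<in> global_space \<F> pull \<TT>" if \<phi>: "\<phi> \<in> vanishing_trace \<F> pull K" for \<phi>
  proof -
    have mem: "\<phi> \<in> \<F> K" and van: "\<And>G. simplex_face G K \<Longrightarrow> G \<noteq> K \<Longrightarrow> face_trace pull K G \<phi> = 0"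
      using \<phi> by (auto simp: vanishing_trace_def)
    have "face_trace pull F G (if F = K then \<phi> else 0) = (if G = K then \<phi> else 0)"
      if "F \<in> \<TT>" "simplex_face G F" for F G
    proof (cases "F = K")
      case True
      then show ?thesis using van[of G] that mem pull_id[OF T[OF K] mem] by (auto simp: face_trace_def)
    next
      case False
      then have "G \<noteq> K" using max that by blast
      with False show ?thesis
        using pull_zero[OF simplicial_map_inclusion[OF T[OF that(1)] that(2)]] by (simp add: face_trace_def)
    qed
    then show ?thesis using K mem T subspace_0[OF subspace_\<F>] by (auto simp: global_space_def)
  qed
  then show ?thesis
    using simplex_face_refl[OF T[OF K]]
    by (auto simp: local_extension_operator_def linear_map_on_def global_trace_def pointwise_def fun_eq_iff)
qed

text \<open>
  The operator sends \<open>\<phi>\<close> to the family of pullbacks along \<open>\<Phi> F\<close> of the simplicial extension of the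
  copy of \<open>\<phi>\<close> on the model simplex. That the family vanishes on simplices not containing \<open>K\<close> also
  makes it compatible with the value zero that is prescribed there.
\<close>

lemma extension_from_simplicial_extension:
  assumes T: "\<And>F. F \<in> \<TT> \<Longrightarrow> is_simplex F" and K: "K \<in> \<TT>" "dim_simplex m K"
    and E0: "simplicial_extension_operator smul \<F> pull m E0"
  shows "\<exists>E. local_extension_operator smul \<F> pull \<TT> K E"
proof -
  let ?T = "T_simplex m" and ?Q = "Q_simplex m"
  have sK: "is_simplex K" using T K by blast
  have cK: "card (vertices K) = Suc m" by (rule card_vertices[OF K(2)])
  have cT: "card (vertices ?T) = Suc m"
    unfolding T_simplex(2) by (subst card_image) (auto intro: inj_on_subset[OF inj_unit_vertex])
  obtain f where f: "bij_betw f (vertices K) (vertices ?T)"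
    using finite_same_card_bij[OF is_simplexD(1)[OF sK] is_simplexD(1)[OF T_simplex(1)]] cK cT by metis
  \<comment> \<open>vertices outside \<open>K\<close> are collapsed to the origin, the vertex of \<open>Q\<close> opposite to \<open>T\<close>\<close>
  define g where "g v = (if v \<in> vertices K then f v else 0)" for v
  have g: "g v \<in> vertices ?Q" for v
    using f by (auto simp: g_def Q_simplex(2) T_simplex(2) bij_betw_def)
  define \<Phi> where "\<Phi> F = (SOME \<Phi>. simplicial_map F ?Q \<Phi> \<and> (\<forall>v\<in>vertices F. \<Phi> v = g v))" for F
  have "simplicial_map F ?Q (\<Phi> F) \<and> (\<forall>v\<in>vertices F. \<Phi> F v = g v)" if "is_simplex F" for F
    using someI_ex[OF simplicial_map_exists[OF that Q_simplex(1) g]] unfolding \<Phi>_def .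
  then have \<Phi>: "simplicial_map F ?Q (\<Phi> F)" and \<Phi>_v: "\<And>v. v \<in> vertices F \<Longrightarrow> \<Phi> F v = g v"
    if "is_simplex F" for F using that by auto
  have restr: "compose G (\<Phi> F) (\<lambda>x\<in>G. x) = \<Phi> G" if F: "is_simplex F" and G: "simplex_face G F" for F G
  proof (rule simplicial_map_eqI)
    have sG: "is_simplex G" using is_simplex_face[OF F G] .
    show "simplicial_map G ?Q (compose G (\<Phi> F) (\<lambda>x\<in>G. x))"
      by (rule simplicial_map_compose[OF simplicial_map_inclusion[OF F G] \<Phi>[OF F]])
    show "simplicial_map G ?Q (\<Phi> G)" by (rule \<Phi>[OF sG])
    show "compose G (\<Phi> F) (\<lambda>x\<in>G. x) v = \<Phi> G v" if "v \<in> vertices G" for v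
      using that \<Phi>_v[OF F] \<Phi>_v[OF sG] vertices_face[OF G] by (simp add: compose_def)
  qed
  have img: "\<Phi> K ` K = ?T"
  proof -
    have "\<Phi> K ` vertices K = vertices ?T"
      using f \<Phi>_v[OF sK] by (auto simp: g_def bij_betw_def)
    then show ?thesis
      using simplicial_map_image[OF \<Phi>[OF sK]] is_simplexD(4)[OF T_simplex(1)] by simp
  qed
  note \<Phi>K = simplex_face_simplicial_image(3)[OF \<Phi>[OF sK], unfolded img]
  obtain \<Psi> where \<Psi>: "simplicial_map ?T K \<Psi>" "\<And>v. v \<in> vertices ?T \<Longrightarrow> \<Psi> v = inv_into (vertices K) f v"
    using simplicial_map_exists[OF T_simplex(1) sK, of m "inv_into (vertices K) f"]
      bij_betw_inv_into[OF f] by (auto simp: bij_betw_def)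
  have inv: "compose K \<Psi> (\<Phi> K) = (\<lambda>x\<in>K. x)"
  proof (rule simplicial_map_eqI)
    show "simplicial_map K K (compose K \<Psi> (\<Phi> K))" by (rule simplicial_map_compose[OF \<Phi>K \<Psi>(1)])
    show "simplicial_map K K (\<lambda>x\<in>K. x)" by (rule simplicial_map_inclusion[OF sK simplex_face_refl[OF sK]])
    show "compose K \<Psi> (\<Phi> K) v = (\<lambda>x\<in>K. x) v" if v: "v \<in> vertices K" for v
    proof -
      have "\<Phi> K v = f v" "f v \<in> vertices ?T" using v \<Phi>_v[OF sK] f by (auto simp: g_def bij_betw_def)
      then show ?thesis
        using v \<Psi>(2) f vertices_subset[of K] by (auto simp: compose_def bij_betw_def inv_into_f_f)
    qed
  qed
  note E0' = E0[unfolded simplicial_extension_operator_def linear_map_on_def]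
  \<comment> \<open>the extension of the model copy of \<open>\<phi>\<close>; it does not depend on the simplex \<open>F\<close>\<close>
  define e where "e \<phi> = E0 (pull ?T K \<Psi> \<phi>)" for \<phi>
  have to_T: "pull ?T K \<Psi> \<phi> \<in> vanishing_trace \<F> pull ?T" if "\<phi> \<in> vanishing_trace \<F> pull K" for \<phi>
    by (rule pull_vanishing_trace[OF \<Psi>(1) _ that]) (simp add: cT cK)
  have e_mem: "e \<phi> \<in> \<F> ?Q" if "\<phi> \<in> vanishing_trace \<F> pull K" for \<phi>
    using E0' to_T[OF that] by (auto simp: e_def)
  have e_T: "face_trace pull ?Q ?T (e \<phi>) = pull ?T K \<Psi> \<phi>" if "\<phi> \<in> vanishing_trace \<F> pull K" for \<phi>
    using E0' to_T[OF that] by (auto simp: e_def)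
  have e_S: "face_trace pull ?Q S (e \<phi>) = 0"
    if "\<phi> \<in> vanishing_trace \<F> pull K" "simplex_face S ?Q" "\<not> simplex_face ?T S" for \<phi> S
    using E0' to_T[OF that(1)] that by (auto simp: e_def)
  have e_add: "e (\<phi> + \<psi>) = e \<phi> + e \<psi>"
    if "\<phi> \<in> vanishing_trace \<F> pull K" "\<psi> \<in> vanishing_trace \<F> pull K" for \<phi> \<psi>
  proof -
    have "\<phi> \<in> \<F> K" "\<psi> \<in> \<F> K" using that by (auto simp: vanishing_trace_def)
    then show ?thesis using E0' to_T[OF that(1)] to_T[OF that(2)] by (simp add: e_def pull_add[OF \<Psi>(1)])
  qed
  have e_scale: "e (smul c \<phi>) = smul c (e \<phi>)" if "\<phi> \<in> vanishing_trace \<F> pull K" for c \<phi>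
  proof -
    have "\<phi> \<in> \<F> K" using that by (auto simp: vanishing_trace_def)
    then show ?thesis using E0' to_T[OF that(1)] by (simp add: e_def pull_scale[OF \<Psi>(1)])
  qed
  define E where "E \<phi> F = (if F \<in> \<TT> \<and> simplex_face K F then pull F ?Q (\<Phi> F) (e \<phi>) else 0)" for \<phi> F
  \<comment> \<open>here \<open>\<Phi> G\<close> misses a vertex of \<open>T\<close>, so the trace of \<open>e \<phi>\<close> on its image is zero\<close>
  have off: "pull G ?Q (\<Phi> G) (e \<phi>) = 0"
    if \<phi>: "\<phi> \<in> vanishing_trace \<F> pull K" and G: "is_simplex G" "\<not> simplex_face K G" for \<phi> G
  proof -
    note im = simplex_face_simplicial_image[OF \<Phi>[OF G(1)]]
    have "\<not> simplex_face ?T (\<Phi> G ` G)"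
    proof
      assume "simplex_face ?T (\<Phi> G ` G)"
      then have "vertices ?T \<subseteq> \<Phi> G ` vertices G" using vertices_face im(2) by blast
      then have *: "vertices ?T \<subseteq> g ` vertices G" using \<Phi>_v[OF G(1)] by auto
      have "v \<in> vertices G" if v: "v \<in> vertices K" for v
      proof -
        have fv: "f v \<in> vertices ?T" using f v by (auto simp: bij_betw_def)
        then obtain w where w: "w \<in> vertices G" "f v = g w" using * by blast
        have "f v \<noteq> 0" using fv unit_vertex_nonzero by (auto simp: T_simplex(2))
        with w have "w \<in> vertices K" "f v = f w" by (auto simp: g_def split: if_splits)
        then show ?thesis using f v w(1) by (auto simp: bij_betw_def dest: inj_onD)
      qed
      then show False using G simplex_face_iff_vertices[OF sK G(1)] by blast
    qed
    then have "face_trace pull ?Q (\<Phi> G ` G) (e \<phi>) = 0" using e_S[OF \<phi> im(1)] by blast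
    then show ?thesis
      using pull_eq_pull_trace_image[OF \<Phi>[OF G(1)] e_mem[OF \<phi>]] pull_zero[OF im(3)] by simp
  qed
  have E_mem: "E \<phi> \<in> global_space \<F> pull \<TT>" if \<phi>: "\<phi> \<in> vanishing_trace \<F> pull K" for \<phi>
  proof -
    have "E \<phi> F \<in> \<F> F" if "F \<in> \<TT>" for F
      using pull_mem[OF \<Phi> e_mem[OF \<phi>]] T[OF that] subspace_0[OF subspace_\<F>] by (auto simp: E_def)
    moreover have "face_trace pull F G (E \<phi> F) = E \<phi> G" if F: "F \<in> \<TT>" and G: "G \<in> \<TT>" "simplex_face G F" for F G
    proof (cases "simplex_face K F")
      case True
      then have "face_trace pull F G (E \<phi> F) = pull G ?Q (\<Phi> G) (e \<phi>)"
        using trace_pull[OF \<Phi>[OF T[OF F]] G(2) e_mem[OF \<phi>]] restr[OF T[OF F] G(2)] F by (simp add: E_def)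
      then show ?thesis using off[OF \<phi> T[OF G(1)]] G(1) by (simp add: E_def)
    next
      case False
      then have "\<not> simplex_face K G" using G simplex_face_trans by blast
      with False show ?thesis
        using pull_zero[OF simplicial_map_inclusion[OF T[OF F] G(2)]] by (simp add: E_def face_trace_def)
    qed
    ultimately show ?thesis by (auto simp: global_space_def E_def)
  qed
  have "E \<phi> K = \<phi>" if \<phi>: "\<phi> \<in> vanishing_trace \<F> pull K" for \<phi>
  proof -
    have mem: "\<phi> \<in> \<F> K" using \<phi> by (simp add: vanishing_trace_def)
    have "E \<phi> K = pull K ?Q (\<Phi> K) (e \<phi>)" using K simplex_face_refl[OF sK] by (simp add: E_def)
    also have "\<dots> = pull K ?T (\<Phi> K) (pull ?T K \<Psi> \<phi>)"
      using pull_eq_pull_trace_image[OF \<Phi>[OF sK] e_mem[OF \<phi>]] e_T[OF \<phi>] by (simp add: img)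
    also have "\<dots> = pull K K (\<lambda>x\<in>K. x) \<phi>"
      using pull_compose[OF \<Phi>K \<Psi>(1) mem] by (simp add: inv)
    finally show ?thesis using pull_id[OF sK mem] by simp
  qed
  moreover have "E (\<phi> + \<psi>) = E \<phi> + E \<psi>"
    if "\<phi> \<in> vanishing_trace \<F> pull K" "\<psi> \<in> vanishing_trace \<F> pull K" for \<phi> \<psi>
    using that T e_mem by (auto simp: E_def fun_eq_iff e_add pull_add[OF \<Phi>])
  moreover have "E (smul c \<phi>) = pointwise smul c (E \<phi>)" if "\<phi> \<in> vanishing_trace \<F> pull K" for c \<phi>
    using that T e_mem by (auto simp: E_def fun_eq_iff pointwise_def e_scale pull_scale[OF \<Phi>])
  ultimately have "local_extension_operator smul \<F> pull \<TT> K E"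
    using E_mem by (auto simp: local_extension_operator_def linear_map_on_def global_trace_def E_def)
  then show ?thesis by blast
qed

lemma local_extension_operators_exist:
  assumes ext: "\<And>m. m < n \<Longrightarrow> \<exists>E. simplicial_extension_operator smul \<F> pull m E"
    and T: "\<And>F. F \<in> \<TT> \<Longrightarrow> \<exists>d\<le>n. dim_simplex d F" and K: "K \<in> \<TT>"
  shows "\<exists>E. local_extension_operator smul \<F> pull \<TT> K E"
proof -
  have simplex: "is_simplex F" if "F \<in> \<TT>" for F using T[OF that] by (auto simp: is_simplex_def)
  obtain m where m: "m \<le> n" "dim_simplex m K" using T[OF K] by blast
  show ?thesis
  proof (cases "m < n")
    case True
    then show ?thesis using extension_from_simplicial_extension[OF simplex K m(2)] ext by blast
  next
    case False
    have "F = K" if F: "F \<in> \<TT>" "simplex_face K F" for F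
    proof (rule ccontr)
      assume "F \<noteq> K"
      then have "card (vertices K) < card (vertices F)"
        using card_vertices_proper_face[OF simplex[OF F(1)] F(2)] by auto
      moreover obtain d where "d \<le> n" "dim_simplex d F" using T[OF F(1)] by blast
      ultimately show False using card_vertices m False by fastforce
    qed
    then show ?thesis using maximal_face_extension[OF simplex K] by blast
  qed
qed

section \<open>The primal and dual decompositions\<close>

text \<open>
  The number of vertices serves as rank. If the traces of \<open>\<phi>\<close> on all simplices with fewer vertices
  are zero, then its trace on \<open>F\<close> has vanishing trace, and the extension of that trace is the
  required summand.
\<close>

lemma geometric_decomposition:
  assumes \<TT>: "complex_of_simplices \<TT>"
    and E: "\<And>F. F \<in> \<TT> \<Longrightarrow> local_extension_operator smul \<F> pull \<TT> F (E F)"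
  shows "is_direct_sum (pointwise smul) (global_space \<F> pull \<TT>) \<TT> (\<lambda>F. E F ` vanishing_trace \<F> pull F)"
proof (rule triangular_direct_sum[where p = global_trace and r = "\<lambda>F. card (vertices F)"])
  have T: "is_simplex F" if "F \<in> \<TT>" for F using \<TT> that by (auto simp: complex_of_simplices_def)
  have down: "K \<in> \<TT>" if "F \<in> \<TT>" "simplex_face K F" for F K using \<TT> that by (auto simp: complex_of_simplices_def)
  note E' = E[unfolded local_extension_operator_def]
  show vs: "vector_space (pointwise smul :: 'k \<Rightarrow> (pt set \<Rightarrow> 'v) \<Rightarrow> pt set \<Rightarrow> 'v)"
    by (rule vector_space_pointwise[OF vector_space_axioms])
  show "finite \<TT>" using \<TT> by (simp add: complex_of_simplices_def)
  show "module.subspace (pointwise smul) (global_space \<F> pull \<TT>)" using T by (rule subspace_global_space)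
  show "module.subspace (pointwise smul) (E F ` vanishing_trace \<F> pull F)" if "F \<in> \<TT>" for F
    using subspace_linear_image[OF vector_space_axioms vs] E'[OF that] subspace_vanishing_trace[OF T[OF that]] by blast
  show "E F ` vanishing_trace \<F> pull F \<subseteq> global_space \<F> pull \<TT>" if "F \<in> \<TT>" for F
    using E'[OF that] by (auto simp: linear_map_on_def)
  show "global_trace K (\<phi> + \<psi>) = global_trace K \<phi> + global_trace K \<psi>" for K and \<phi> \<psi> :: "pt set \<Rightarrow> 'v"
    by (simp add: global_trace_def)
  show "global_trace K w = 0"
    if F: "F \<in> \<TT>" "K \<in> \<TT>" "F \<noteq> K" "\<not> card (vertices F) < card (vertices K)"
      "w \<in> E F ` vanishing_trace \<F> pull F" for F K w
  proof -
    have "\<not> simplex_face F K" using card_vertices_proper_face[OF T[OF F(2)]] F(3,4) by blast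
    then show ?thesis using E'[OF F(1)] F(2,5) by auto
  qed
  show "\<exists>!w. w \<in> E F ` vanishing_trace \<F> pull F \<and> global_trace F w = global_trace F \<phi>"
    if F: "F \<in> \<TT>" and \<phi>: "\<phi> \<in> global_space \<F> pull \<TT>"
      and below: "\<And>K. K \<in> \<TT> \<Longrightarrow> card (vertices K) < card (vertices F) \<Longrightarrow> global_trace K \<phi> = 0" for F \<phi>
  proof -
    have "face_trace pull F K (\<phi> F) = 0" if K: "simplex_face K F" "K \<noteq> F" for K
      using below[OF down[OF F K(1)] card_vertices_proper_face[OF T[OF F] K]] \<phi> F down[OF F K(1)] K(1)
      by (simp add: global_space_def global_trace_def)
    then have v: "\<phi> F \<in> vanishing_trace \<F> pull F" using \<phi> F by (simp add: vanishing_trace_def global_space_def)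
    have s: "\<And>\<psi>. \<psi> \<in> vanishing_trace \<F> pull F \<Longrightarrow> global_trace F (E F \<psi>) = \<psi>" using E'[OF F] by blast
    show ?thesis
    proof (rule ex1I[of _ "E F (\<phi> F)"])
      show "E F (\<phi> F) \<in> E F ` vanishing_trace \<F> pull F \<and> global_trace F (E F (\<phi> F)) = global_trace F \<phi>"
        using v s[OF v] by (simp add: global_trace_def)
    qed (use s in \<open>auto simp: global_trace_def\<close>)
  qed
  show "\<phi> = 0" if "\<phi> \<in> global_space \<F> pull \<TT>" "\<And>K. K \<in> \<TT> \<Longrightarrow> global_trace K \<phi> = 0" for \<phi>
    using that by (auto simp: global_space_def global_trace_def fun_eq_iff)
qed

text \<open>
  The functional \<open>\<beta> \<circ> tr F\<close> is tested against the extensions from \<open>K\<close>, which have zero trace on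
  \<open>F\<close> unless \<open>K \<le> F\<close>. The elimination therefore starts with the largest simplices, and a functional
  is detected by these tests because the extensions span the global space.
\<close>

lemma dual_decomposition:
  assumes \<TT>: "complex_of_simplices \<TT>"
    and E: "\<And>F. F \<in> \<TT> \<Longrightarrow> local_extension_operator smul \<F> pull \<TT> F (E F)"
    and D: "\<And>F. F \<in> \<TT> \<Longrightarrow> dagger_space smul \<F> pull F (D F)"
  shows "is_direct_sum (pointwise (*)) (dual_space (pointwise smul) (global_space \<F> pull \<TT>)) \<TT>
    (\<lambda>F. dual_map (global_space \<F> pull \<TT>) (global_trace F) ` D F)"
proof -
  let ?G = "global_space \<F> pull \<TT>" and ?V = "vanishing_trace \<F> pull"
  have T: "is_simplex F" if "F \<in> \<TT>" for F using \<TT> that by (auto simp: complex_of_simplices_def)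
  have fin: "finite \<TT>" using \<TT> by (simp add: complex_of_simplices_def)
  \<comment> \<open>an upper bound that turns the vertex count into a decreasing rank\<close>
  obtain N where N: "\<And>F. F \<in> \<TT> \<Longrightarrow> card (vertices F) < N"
    using fin finite_nat_set_iff_bounded[of "(\<lambda>F. card (vertices F)) ` \<TT>"] by auto
  note E' = E[unfolded local_extension_operator_def]
  interpret G: vector_space "pointwise smul :: 'k \<Rightarrow> (pt set \<Rightarrow> 'v) \<Rightarrow> pt set \<Rightarrow> 'v"
    by (rule vector_space_pointwise[OF vector_space_axioms])
  have subG: "G.subspace ?G" using T by (rule subspace_global_space)
  have tr: "linear_map_on (pointwise smul) smul ?G (\<F> F) (global_trace F)" if "F \<in> \<TT>" for F
    using that by (auto simp: linear_map_on_def global_trace_def pointwise_def global_space_def)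
  have DD: "\<beta> \<in> dual_space smul (\<F> F)" if "F \<in> \<TT>" "\<beta> \<in> D F" for F \<beta>
    using D[OF that(1)] that(2) by (auto simp: dagger_space_def)
  have EG: "E F \<psi> \<in> ?G" if "F \<in> \<TT>" "\<psi> \<in> ?V F" for F \<psi>
    using E'[OF that(1)] that(2) by (auto simp: linear_map_on_def)
  have dsum: "is_direct_sum (pointwise smul) ?G \<TT> (\<lambda>F. E F ` ?V F)"
    using geometric_decomposition[OF \<TT> E] .
  show ?thesis
  proof (rule triangular_direct_sum[where p = "\<lambda>F. dual_map (?V F) (E F)" and r = "\<lambda>F. N - card (vertices F)"])
    show vs: "vector_space (pointwise (*) :: 'k \<Rightarrow> ((pt set \<Rightarrow> 'v) \<Rightarrow> 'k) \<Rightarrow> (pt set \<Rightarrow> 'v) \<Rightarrow> 'k)"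
      by (rule vector_space_pointwise[OF vector_space_over_itself.vector_space_axioms])
    have vs': "vector_space (pointwise (*) :: 'k \<Rightarrow> ('v \<Rightarrow> 'k) \<Rightarrow> 'v \<Rightarrow> 'k)"
      by (rule vector_space_pointwise[OF vector_space_over_itself.vector_space_axioms])
    show "finite \<TT>" by (rule fin)
    show "module.subspace (pointwise (*)) (dual_space (pointwise smul) ?G)"
      by (rule subspace_dual_space[OF G.vector_space_axioms subG])
    show "module.subspace (pointwise (*)) (dual_map ?G (global_trace F) ` D F)" if F: "F \<in> \<TT>" for F
    proof (rule subspace_linear_image[OF vs' vs])
      show "linear_map_on (pointwise (*)) (pointwise (*)) (D F) UNIV (dual_map ?G (global_trace F))"
        by (auto simp: linear_map_on_def dual_map_def pointwise_def fun_eq_iff)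
      show "module.subspace (pointwise (*)) (D F)" using D[OF F] by (simp add: dagger_space_def)
    qed
    show "dual_map ?G (global_trace F) ` D F \<subseteq> dual_space (pointwise smul) ?G" if F: "F \<in> \<TT>" for F
      using dual_map_mem_dual_space[OF tr[OF F] DD[OF F] G.vector_space_axioms subG] by blast
    show "dual_map (?V F) (E F) (\<alpha> + \<beta>) = dual_map (?V F) (E F) \<alpha> + dual_map (?V F) (E F) \<beta>"
      for F and \<alpha> \<beta> :: "(pt set \<Rightarrow> 'v) \<Rightarrow> 'k"
      by (simp add: dual_map_def fun_eq_iff)
    show "dual_map (?V K) (E K) w = 0"
      if F: "F \<in> \<TT>" "K \<in> \<TT>" "F \<noteq> K" "\<not> N - card (vertices F) < N - card (vertices K)"
        "w \<in> dual_map ?G (global_trace F) ` D F" for F K w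
    proof -
      obtain \<beta> where \<beta>: "\<beta> \<in> D F" "w = dual_map ?G (global_trace F) \<beta>" using F(5) by blast
      have "\<not> simplex_face K F"
        using card_vertices_proper_face[OF T[OF F(1)], of K] F(3,4) N[OF F(1)] by force
      then have "global_trace F (E K \<psi>) = 0" if "\<psi> \<in> ?V K" for \<psi>
        using E'[OF F(2)] F(1) that by blast
      then show ?thesis
        using EG[OF F(2)] dual_space_zero[OF vector_space_axioms subspace_\<F>[OF T[OF F(1)]] DD[OF F(1) \<beta>(1)]]
        by (auto simp: \<beta>(2) dual_map_def fun_eq_iff)
    qed
    show "\<exists>!w. w \<in> dual_map ?G (global_trace F) ` D F \<and> dual_map (?V F) (E F) w = dual_map (?V F) (E F) \<alpha>"
      if F: "F \<in> \<TT>" and \<alpha>: "\<alpha> \<in> dual_space (pointwise smul) ?G" for F \<alpha>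
    proof -
      \<comment> \<open>on the diagonal the test restricts \<open>\<beta>\<close> to the vanishing-trace space, as \<open>tr F \<circ> E F\<close> is the inclusion\<close>
      have res: "dual_map (?V F) (E F) (dual_map ?G (global_trace F) \<beta>) = dual_map (?V F) (\<lambda>\<phi>. \<phi>) \<beta>" for \<beta> :: "'v \<Rightarrow> 'k"
        using E'[OF F] EG[OF F] by (auto simp: dual_map_def fun_eq_iff)
      have "dual_map (?V F) (E F) \<alpha> \<in> dual_space smul (?V F)"
        using dual_map_mem_dual_space[OF _ \<alpha> vector_space_axioms subspace_vanishing_trace[OF T[OF F]]] E'[OF F] by blast
      moreover have bij: "bij_betw (dual_map (?V F) (\<lambda>\<phi>. \<phi>)) (D F) (dual_space smul (?V F))"
        using D[OF F] by (simp add: dagger_space_def)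
      ultimately obtain \<beta> where \<beta>: "\<beta> \<in> D F" "dual_map (?V F) (\<lambda>\<phi>. \<phi>) \<beta> = dual_map (?V F) (E F) \<alpha>"
        by (metis bij_betw_imp_surj_on imageE)
      show ?thesis
      proof (rule ex1I[of _ "dual_map ?G (global_trace F) \<beta>"])
        show "w = dual_map ?G (global_trace F) \<beta>"
          if w: "w \<in> dual_map ?G (global_trace F) ` D F \<and> dual_map (?V F) (E F) w = dual_map (?V F) (E F) \<alpha>" for w
        proof -
          obtain \<beta>' where \<beta>': "\<beta>' \<in> D F" "w = dual_map ?G (global_trace F) \<beta>'" using w by blast
          then have "\<beta>' = \<beta>"
            using inj_onD[OF bij_betw_imp_inj_on[OF bij], of \<beta>' \<beta>] w \<beta> res by simp
          with \<beta>'(2) show ?thesis by simp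
        qed
      qed (use \<beta> res in simp)
    qed
    show "\<alpha> = 0" if \<alpha>: "\<alpha> \<in> dual_space (pointwise smul) ?G"
      and van: "\<And>F. F \<in> \<TT> \<Longrightarrow> dual_map (?V F) (E F) \<alpha> = 0" for \<alpha> :: "(pt set \<Rightarrow> 'v) \<Rightarrow> 'k"
    proof
      fix \<phi>
      show "\<alpha> \<phi> = 0 \<phi>"
      proof (cases "\<phi> \<in> ?G")
        case True
        then obtain w where w: "w \<in> (\<Pi>\<^sub>E F\<in>\<TT>. E F ` ?V F)" "\<phi> = (\<Sum>F\<in>\<TT>. w F)"
          using dsum unfolding is_direct_sum_def by blast
        have wG: "w F \<in> ?G" and w0: "\<alpha> (w F) = 0" if F: "F \<in> \<TT>" for F
        proof -
          obtain \<psi> where \<psi>: "\<psi> \<in> ?V F" "w F = E F \<psi>" using w(1) F by blast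
          show "w F \<in> ?G" using EG[OF F \<psi>(1)] \<psi>(2) by simp
          show "\<alpha> (w F) = 0" using fun_cong[OF van[OF F], of \<psi>] \<psi> by (simp add: dual_map_def)
        qed
        have "sum w J \<in> ?G \<and> \<alpha> (sum w J) = 0" if "finite J" "J \<subseteq> \<TT>" for J
          using that
        proof (induction J rule: finite_induct)
          case empty
          show ?case
            unfolding sum.empty using G.subspace_0[OF subG] dual_space_zero[OF G.vector_space_axioms subG \<alpha>] by blast
        next
          case (insert F J)
          then have IH: "sum w J \<in> ?G" "\<alpha> (sum w J) = 0" and F: "F \<in> \<TT>" by auto
          have "\<alpha> (w F + sum w J) = \<alpha> (w F) + \<alpha> (sum w J)"
            using \<alpha> wG[OF F] IH(1) by (simp only: dual_space_def linear_map_on_def mem_Collect_eq)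
          then show ?case
            unfolding sum.insert[OF insert.hyps]
            using G.subspace_add[OF subG wG[OF F] IH(1)] w0[OF F] IH(2) by (simp only: add_0)
        qed
        then show ?thesis using fin w(2) by simp
      next
        case False
        then show ?thesis using \<alpha> by (simp add: dual_space_def)
      qed
    qed
  qed
qed

end

theorem corollary3p10:
  fixes smul :: "'k::field \<Rightarrow> 'v::ab_group_add \<Rightarrow> 'v"
    and \<F> :: "pt set \<Rightarrow> 'v set"
    and pull :: "pt set \<Rightarrow> pt set \<Rightarrow> (pt \<Rightarrow> pt) \<Rightarrow> 'v \<Rightarrow> 'v"
    and n :: nat
    and \<TT> :: "pt set set"
  assumes "simplicial_function_space smul \<F> pull"
    and "\<forall>m<n. \<exists>E. simplicial_extension_operator smul \<F> pull m E"
    and "complex_of_simplices \<TT>"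
    and "\<forall>F\<in>\<TT>. \<exists>d\<le>n. dim_simplex d F"
  shows "(\<exists>E. (\<forall>F\<in>\<TT>. local_extension_operator smul \<F> pull \<TT> F (E F)) \<and>
              is_direct_sum (pointwise smul) (global_space \<F> pull \<TT>) \<TT>
                (\<lambda>F. E F ` vanishing_trace \<F> pull F)) \<and>
         (\<forall>D. (\<forall>F\<in>\<TT>. dagger_space smul \<F> pull F (D F)) \<longrightarrow>
              is_direct_sum (pointwise (*))
                (dual_space (pointwise smul) (global_space \<F> pull \<TT>)) \<TT>
                (\<lambda>F. dual_map (global_space \<F> pull \<TT>) (global_trace F) ` D F))"
proof -
  interpret simplicial_function_space smul \<F> pull by fact
  have "\<forall>F\<in>\<TT>. \<exists>E. local_extension_operator smul \<F> pull \<TT> F E"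
    using local_extension_operators_exist assms(2,4) by blast
  then obtain E where E: "\<forall>F\<in>\<TT>. local_extension_operator smul \<F> pull \<TT> F (E F)"
    using bchoice by metis
  then show ?thesis
    using geometric_decomposition[OF assms(3)] dual_decomposition[OF assms(3)] by blast
qed

end
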